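(* Assume that $\max_{i\in\{1,\dots,n-1\}}(s_{i+1}-s_i)\to0$ as $n\to\infty$ and that $K<+\infty$. Then $$\liminf_{n\to\infty}\tau_n^2\ \ge\ 2\left(\sum_{k=1}^Kw_k\right)^2.$$
   Context: $Z=\{Z(s),s\in[0,1]\}$ is a stationary zero-mean Gaussian process with covariance $\mathrm{cov}\{Z(s),Z(t)\}=\sigma_0^2e^{-\theta_0|s-t|}$, for fixed $\theta_0,\sigma_0^2\in(0,\infty)$. For each $n$, the observation points are $s_1<\dots<s_n$ in $[0,1]$, where $s_i=s_i^{(n)}$ is a (deterministic) triangular array. $(w_k)_{k\ge1}$ is a fixed sequence of non-negative numbers, not all zero (not depending on $n$), and $K=\max\{k\ge 1: w_k\ne0\}$ (with $K=+\infty$ if infinitely many $w_k$ are non-zero). For $i,k\ge1$ with $i+k\le n$, $$W^2_{i,i+k}=\frac{\{Z(s_{i+k})-e^{-\theta_0(s_{i+k}-s_i)}Z(s_i)\}^2}{\sigma_0^2(1-e^{-2\theta_0(s_{i+k}-s_i)})},\qquad \tau_n^2=\frac1n\,\mathrm{var}\left\{\sum_{i=1}^{n-1}\sum_{k=1}^{\min\{K,n-i\}}w_k\left(W^2_{i,i+k}-1\right)\right\}.$$ *)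

theory Defs
  imports "HOL-Probability.Probability" "HOL-Library.Extended_Nat"
begin

definition covariance :: "'a measure \<Rightarrow> ('a \<Rightarrow> real) \<Rightarrow> ('a \<Rightarrow> real) \<Rightarrow> real" where
  "covariance M X Y =
     prob_space.expectation M (\<lambda>\<omega>. (X \<omega> - prob_space.expectation M X) * (Y \<omega> - prob_space.expectation M Y))"

text \<open>The second disjunct admits the degenerate normal laws \<open>N(\<mu>, 0)\<close>, which have no density;
  they arise from the trivial linear combination in \<open>gaussian_process\<close>.\<close>

definition gaussian_rv :: "'a measure \<Rightarrow> ('a \<Rightarrow> real) \<Rightarrow> bool" where
  "gaussian_rv M X \<longleftrightarrow> X \<in> borel_measurable M \<and>
     ((\<exists>\<mu> \<sigma>. \<sigma> > 0 \<and> distributed M lborel X (normal_density \<mu> \<sigma>)) \<or>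
      (\<exists>\<mu>. AE \<omega> in M. X \<omega> = \<mu>))"

definition gaussian_process :: "'a measure \<Rightarrow> 't set \<Rightarrow> ('t \<Rightarrow> 'a \<Rightarrow> real) \<Rightarrow> bool" where
  "gaussian_process M T Z \<longleftrightarrow>
     (\<forall>t\<in>T. Z t \<in> borel_measurable M) \<and>
     (\<forall>F c. finite F \<and> F \<subseteq> T \<longrightarrow> gaussian_rv M (\<lambda>\<omega>. \<Sum>t\<in>F. c t * Z t \<omega>))"

text \<open>Strict stationarity: finite-dimensional laws are invariant under every shift that stays
  inside the index set.\<close>

definition stationary_process :: "'a measure \<Rightarrow> real set \<Rightarrow> (real \<Rightarrow> 'a \<Rightarrow> real) \<Rightarrow> bool" where
  "stationary_process M T Z \<longleftrightarrow>
     (\<forall>F h. finite F \<and> F \<subseteq> T \<and> (\<lambda>t. t + h) ` F \<subseteq> T \<longrightarrow>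
        distr M (\<Pi>\<^sub>M t\<in>F. borel) (\<lambda>\<omega>. \<lambda>t\<in>F. Z (t + h) \<omega>) =
        distr M (\<Pi>\<^sub>M t\<in>F. borel) (\<lambda>\<omega>. \<lambda>t\<in>F. Z t \<omega>))"

text \<open>In \<open>enat\<close>, the supremum of a finite nonempty set is its maximum, and that of an infinite
  set is \<open>\<infinity>\<close>. The value \<open>w 0\<close> is never used.\<close>

definition max_lag :: "(nat \<Rightarrow> real) \<Rightarrow> enat" where
  "max_lag w = Sup (enat ` {k. k \<ge> 1 \<and> w k \<noteq> 0})"

text \<open>\<open>W_sq \<theta> \<sigma>2 Z x i k\<close> is \<open>W\<^sup>2\<close> for the pair \<open>(i, i + k)\<close> of the points \<open>x\<close>;
  \<open>\<sigma>2\<close> is the variance, not the standard deviation.\<close>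

definition W_sq ::
  "real \<Rightarrow> real \<Rightarrow> (real \<Rightarrow> 'a \<Rightarrow> real) \<Rightarrow> (nat \<Rightarrow> real) \<Rightarrow> nat \<Rightarrow> nat \<Rightarrow> 'a \<Rightarrow> real" where
  "W_sq \<theta> \<sigma>2 Z x i k \<omega> =
     (Z (x (i + k)) \<omega> - exp (- \<theta> * (x (i + k) - x i)) * Z (x i) \<omega>)\<^sup>2 /
     (\<sigma>2 * (1 - exp (- 2 * \<theta> * (x (i + k) - x i))))"

definition tau_sq ::
  "'a measure \<Rightarrow> real \<Rightarrow> real \<Rightarrow> (real \<Rightarrow> 'a \<Rightarrow> real) \<Rightarrow> (nat \<Rightarrow> real) \<Rightarrow> (nat \<Rightarrow> nat \<Rightarrow> real) \<Rightarrow> nat \<Rightarrow> real" where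
  "tau_sq M \<theta> \<sigma>2 Z w s n =
     1 / real n * prob_space.variance M
       (\<lambda>\<omega>. \<Sum>i=1..n - 1. \<Sum>k=1..the_enat (min (max_lag w) (enat (n - i))).
               w k * (W_sq \<theta> \<sigma>2 Z (s n) i k \<omega> - 1))"

end

theory Submission
  imports Defs "HOL-Real_Asymp.Real_Asymp"
begin

text \<open>The innovations \<open>\<epsilon> m = W (m, m + 1)\<close> are orthonormal, and each \<open>W (i, i + k)\<close> lies in the
  span of \<open>\<epsilon> i, \<dots>, \<epsilon> (i + k - 1)\<close>, so its squared correlations with these sum to \<open>1\<close>. By the
  Gaussian identity \<open>cov (U\<^sup>2, V\<^sup>2) = 2 (cov (U, V))\<^sup>2\<close>, the sum \<open>X\<close> of all \<open>w k (W (i, i + k)\<^sup>2 - 1)\<close> and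
  \<open>Y = (\<Sum>m<n. (\<epsilon> m)\<^sup>2 - 1)\<close> then satisfy \<open>cov (X, Y) \<ge> 2 S\<close> and \<open>var Y = 2 (n - 1)\<close>, with \<open>S\<close> the
  sum of all weights in \<open>X\<close>, and Cauchy-Schwarz gives \<open>var X \<ge> 2 S\<^sup>2 / (n - 1)\<close>. Up to boundary terms
  \<open>S\<close> is \<open>n\<close> times the sum of the \<open>w k\<close>.\<close>

section \<open>Moments of a centred Gaussian variable\<close>

text \<open>Expressing the fourth moment through the second, without a scale parameter, covers the
  degenerate law as well, so later arguments need no case distinction.\<close>

lemma (in prob_space) centred_gaussian_moments:
  assumes "gaussian_rv M X" "expectation X = 0"
  shows "integrable M X" "integrable M (\<lambda>\<omega>. (X \<omega>)\<^sup>2)" "integrable M (\<lambda>\<omega>. X \<omega> ^ 4)"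
    "expectation (\<lambda>\<omega>. X \<omega> ^ 4) = 3 * (expectation (\<lambda>\<omega>. (X \<omega>)\<^sup>2))\<^sup>2"
proof -
  have meas [measurable]: "X \<in> borel_measurable M"
    using assms(1) by (simp add: gaussian_rv_def)
  consider (normal) \<mu> \<sigma> where "\<sigma> > 0" "distributed M lborel X (normal_density \<mu> \<sigma>)"
    | (const) \<mu> where "AE \<omega> in M. X \<omega> = \<mu>"
    using assms(1) unfolding gaussian_rv_def by blast
  then have "integrable M X \<and> integrable M (\<lambda>\<omega>. (X \<omega>)\<^sup>2) \<and> integrable M (\<lambda>\<omega>. X \<omega> ^ 4) \<and>
    expectation (\<lambda>\<omega>. X \<omega> ^ 4) = 3 * (expectation (\<lambda>\<omega>. (X \<omega>)\<^sup>2))\<^sup>2"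
  proof cases
    case normal
    have \<mu>: "\<mu> = 0"
      using normal_distributed_expectation[OF normal] assms(2) by simp
    have int: "integrable M (\<lambda>\<omega>. X \<omega> ^ k)" for k
      using distributed_integrable[OF normal(2), of "\<lambda>x. x ^ k"]
        integrable_normal_moment[OF normal(1), of 0 k] \<mu> by simp
    have mom: "expectation (\<lambda>\<omega>. X \<omega> ^ (2 * k)) = fact (2 * k) / ((2 / \<sigma>\<^sup>2) ^ k * fact k)" for k
      using distributed_integral[OF normal(2), of "\<lambda>x. x ^ (2 * k)"]
        integral_normal_moment_even[OF normal(1), of 0 k] \<mu> by simp
    have "expectation (\<lambda>\<omega>. (X \<omega>)\<^sup>2) = \<sigma>\<^sup>2"
      using mom[of 1] by simp
    moreover have "expectation (\<lambda>\<omega>. X \<omega> ^ 4) = 3 * (\<sigma>\<^sup>2)\<^sup>2"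
      using mom[of 2] by (simp add: power_divide fact_numeral)
    ultimately show ?thesis
      using int[of 1] int[of 2] int[of 4] by simp
  next
    \<comment> \<open>A constant with mean 0 is 0 almost everywhere, and the moment identity becomes
      0 = 0.\<close>
    case const
    have "expectation X = \<mu>"
      using integral_cong_AE[of X M "\<lambda>_. \<mu>"] const prob_space by simp
    then have X0: "AE \<omega> in M. X \<omega> = 0"
      using const assms(2) by simp
    have "integrable M (\<lambda>\<omega>. X \<omega> ^ k) \<and> expectation (\<lambda>\<omega>. X \<omega> ^ k) = 0" if "k > 0" for k
    proof -
      have "AE \<omega> in M. X \<omega> ^ k = 0"
        using X0 by eventually_elim (use that in auto)
      then show ?thesis
        using integrable_cong_AE[of "\<lambda>\<omega>. X \<omega> ^ k" M "\<lambda>_. 0"]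
          integral_cong_AE[of "\<lambda>\<omega>. X \<omega> ^ k" M "\<lambda>_. 0"] by simp
    qed
    from this[of 1] this[of 2] this[of 4] show ?thesis by simp
  qed
  then show "integrable M X" "integrable M (\<lambda>\<omega>. (X \<omega>)\<^sup>2)" "integrable M (\<lambda>\<omega>. X \<omega> ^ 4)"
    "expectation (\<lambda>\<omega>. X \<omega> ^ 4) = 3 * (expectation (\<lambda>\<omega>. (X \<omega>)\<^sup>2))\<^sup>2"
    by blast+
qed

section \<open>Squares in a centred Gaussian space\<close>

text \<open>Joint Gaussianity enters only through closure under linear combinations: each
  combination is univariate Gaussian, so mixed moments follow by polarisation and no joint density
  is needed.\<close>

locale centred_gaussian_space = prob_space M for M :: "'a measure" +
  fixes H :: "('a \<Rightarrow> real) set"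
  assumes gaussian: "X \<in> H \<Longrightarrow> gaussian_rv M X"
    and centred: "X \<in> H \<Longrightarrow> expectation X = 0"
    and lincomb: "X \<in> H \<Longrightarrow> Y \<in> H \<Longrightarrow> (\<lambda>\<omega>. a * X \<omega> + b * Y \<omega>) \<in> H"
begin

lemma scale: "X \<in> H \<Longrightarrow> (\<lambda>\<omega>. a * X \<omega>) \<in> H"
  using lincomb[of X X a 0] by simp

lemmas moments = centred_gaussian_moments[OF gaussian centred]

lemma integrable_mult:
  assumes "X \<in> H" "Y \<in> H"
  shows "integrable M (\<lambda>\<omega>. X \<omega> * Y \<omega>)"
proof -
  have eq: "X \<omega> * Y \<omega> = ((1 * X \<omega> + 1 * Y \<omega>)\<^sup>2 - (X \<omega>)\<^sup>2 - (Y \<omega>)\<^sup>2) / 2" for \<omega>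
    by (simp add: power2_sum)
  show ?thesis
    unfolding eq using assms lincomb[OF assms, of 1 1]
    by (intro integrable_divide Bochner_Integration.integrable_diff moments(2))
qed

lemma expectation_mult_lincomb:
  assumes "X \<in> H" "Y \<in> H" "X' \<in> H" "Y' \<in> H"
  shows "expectation (\<lambda>\<omega>. (X \<omega> - a * Y \<omega>) * (X' \<omega> - b * Y' \<omega>)) =
    expectation (\<lambda>\<omega>. X \<omega> * X' \<omega>) - b * expectation (\<lambda>\<omega>. X \<omega> * Y' \<omega>)
    - a * expectation (\<lambda>\<omega>. Y \<omega> * X' \<omega>) + a * b * expectation (\<lambda>\<omega>. Y \<omega> * Y' \<omega>)"
proof -
  have eq: "(X \<omega> - a * Y \<omega>) * (X' \<omega> - b * Y' \<omega>) =
    X \<omega> * X' \<omega> - b * (X \<omega> * Y' \<omega>) - a * (Y \<omega> * X' \<omega>) + a * b * (Y \<omega> * Y' \<omega>)" for \<omega>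
    by (simp add: algebra_simps)
  show ?thesis
    unfolding eq using assms by (simp add: integrable_mult)
qed

text \<open>Polarisation of \<open>E X\<^sup>4 = 3 (E X\<^sup>2)\<^sup>2\<close> along \<open>X + Y\<close> and \<open>X - Y\<close>.\<close>

lemma expectation_squares:
  assumes "X \<in> H" "Y \<in> H"
  shows "integrable M (\<lambda>\<omega>. (X \<omega>)\<^sup>2 * (Y \<omega>)\<^sup>2)"
    "expectation (\<lambda>\<omega>. (X \<omega>)\<^sup>2 * (Y \<omega>)\<^sup>2) =
      expectation (\<lambda>\<omega>. (X \<omega>)\<^sup>2) * expectation (\<lambda>\<omega>. (Y \<omega>)\<^sup>2)
      + 2 * (expectation (\<lambda>\<omega>. X \<omega> * Y \<omega>))\<^sup>2"
proof -
  define P where "P a = (\<lambda>\<omega>. 1 * X \<omega> + a * Y \<omega>)" for a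
  define A where "A = expectation (\<lambda>\<omega>. (X \<omega>)\<^sup>2)"
  define B where "B = expectation (\<lambda>\<omega>. (Y \<omega>)\<^sup>2)"
  define C where "C = expectation (\<lambda>\<omega>. X \<omega> * Y \<omega>)"
  have P: "P a \<in> H" for a
    unfolding P_def using assms by (rule lincomb)
  \<comment> \<open>In the sum of the fourth powers of X + Y and X - Y the odd terms cancel, and the
    mixed term has coefficient 12.\<close>
  have eq: "(X \<omega>)\<^sup>2 * (Y \<omega>)\<^sup>2 =
      (P 1 \<omega> ^ 4 + P (-1) \<omega> ^ 4 - 2 * X \<omega> ^ 4 - 2 * Y \<omega> ^ 4) / 12" for \<omega>
    unfolding P_def by (simp add: eval_nat_numeral algebra_simps)
  have sq: "(P a \<omega>)\<^sup>2 = (X \<omega>)\<^sup>2 + 2 * a * (X \<omega> * Y \<omega>) + a\<^sup>2 * (Y \<omega>)\<^sup>2" for a \<omega>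
    unfolding P_def by (simp add: eval_nat_numeral algebra_simps)
  have P2: "expectation (\<lambda>\<omega>. (P a \<omega>)\<^sup>2) = A + 2 * a * C + a\<^sup>2 * B" for a
    unfolding sq A_def B_def C_def using assms by (simp add: integrable_mult moments(2))
  show "integrable M (\<lambda>\<omega>. (X \<omega>)\<^sup>2 * (Y \<omega>)\<^sup>2)"
    unfolding eq using assms P
    by (intro integrable_divide Bochner_Integration.integrable_diff
        Bochner_Integration.integrable_add integrable_mult_right moments(3))
  have "expectation (\<lambda>\<omega>. (X \<omega>)\<^sup>2 * (Y \<omega>)\<^sup>2) =
      (3 * (A + 2 * C + B)\<^sup>2 + 3 * (A - 2 * C + B)\<^sup>2 - 2 * (3 * A\<^sup>2) - 2 * (3 * B\<^sup>2)) / 12"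
    unfolding eq using assms P P2[of 1] P2[of "-1"]
    by (simp add: moments(3,4) flip: A_def B_def)
  also have "\<dots> = A * B + 2 * C\<^sup>2"
    by (simp add: power2_eq_square algebra_simps)
  finally show "expectation (\<lambda>\<omega>. (X \<omega>)\<^sup>2 * (Y \<omega>)\<^sup>2) =
      expectation (\<lambda>\<omega>. (X \<omega>)\<^sup>2) * expectation (\<lambda>\<omega>. (Y \<omega>)\<^sup>2)
      + 2 * (expectation (\<lambda>\<omega>. X \<omega> * Y \<omega>))\<^sup>2"
    unfolding A_def B_def C_def .
qed

text \<open>At unit variances the product of second moments equals 1 and cancels against the
  centring. What remains is never negative, whatever the sign of the correlation.\<close>

lemma covariance_normalised_squares:
  assumes "X \<in> H" "Y \<in> H" "expectation (\<lambda>\<omega>. (X \<omega>)\<^sup>2) = 1" "expectation (\<lambda>\<omega>. (Y \<omega>)\<^sup>2) = 1"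
  shows "integrable M (\<lambda>\<omega>. ((X \<omega>)\<^sup>2 - 1) * ((Y \<omega>)\<^sup>2 - 1))"
    "expectation (\<lambda>\<omega>. ((X \<omega>)\<^sup>2 - 1) * ((Y \<omega>)\<^sup>2 - 1)) = 2 * (expectation (\<lambda>\<omega>. X \<omega> * Y \<omega>))\<^sup>2"
proof -
  have eq: "((X \<omega>)\<^sup>2 - 1) * ((Y \<omega>)\<^sup>2 - 1) = (X \<omega>)\<^sup>2 * (Y \<omega>)\<^sup>2 - (X \<omega>)\<^sup>2 - (Y \<omega>)\<^sup>2 + 1" for \<omega>
    by (simp add: algebra_simps)
  show "integrable M (\<lambda>\<omega>. ((X \<omega>)\<^sup>2 - 1) * ((Y \<omega>)\<^sup>2 - 1))"
    "expectation (\<lambda>\<omega>. ((X \<omega>)\<^sup>2 - 1) * ((Y \<omega>)\<^sup>2 - 1)) = 2 * (expectation (\<lambda>\<omega>. X \<omega> * Y \<omega>))\<^sup>2"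
    unfolding eq using assms by (simp_all add: expectation_squares moments(2) prob_space)
qed

lemma covariance_sums_of_squares:
  assumes "finite I" "finite J"
    and "\<And>p. p \<in> I \<Longrightarrow> U p \<in> H" "\<And>p. p \<in> I \<Longrightarrow> expectation (\<lambda>\<omega>. (U p \<omega>)\<^sup>2) = 1"
    and "\<And>q. q \<in> J \<Longrightarrow> V q \<in> H" "\<And>q. q \<in> J \<Longrightarrow> expectation (\<lambda>\<omega>. (V q \<omega>)\<^sup>2) = 1"
  shows "integrable M (\<lambda>\<omega>. (\<Sum>p\<in>I. a p * ((U p \<omega>)\<^sup>2 - 1)) * (\<Sum>q\<in>J. b q * ((V q \<omega>)\<^sup>2 - 1)))"
    "expectation (\<lambda>\<omega>. (\<Sum>p\<in>I. a p * ((U p \<omega>)\<^sup>2 - 1)) * (\<Sum>q\<in>J. b q * ((V q \<omega>)\<^sup>2 - 1))) =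
      (\<Sum>p\<in>I. \<Sum>q\<in>J. a p * b q * (2 * (expectation (\<lambda>\<omega>. U p \<omega> * V q \<omega>))\<^sup>2))"
proof -
  have eq: "(\<Sum>p\<in>I. a p * ((U p \<omega>)\<^sup>2 - 1)) * (\<Sum>q\<in>J. b q * ((V q \<omega>)\<^sup>2 - 1)) =
      (\<Sum>p\<in>I. \<Sum>q\<in>J. a p * b q * (((U p \<omega>)\<^sup>2 - 1) * ((V q \<omega>)\<^sup>2 - 1)))" for \<omega>
    by (simp add: sum_product mult_ac)
  note cov = covariance_normalised_squares[OF assms(3) assms(5) assms(4) assms(6)]
  show "integrable M (\<lambda>\<omega>. (\<Sum>p\<in>I. a p * ((U p \<omega>)\<^sup>2 - 1)) * (\<Sum>q\<in>J. b q * ((V q \<omega>)\<^sup>2 - 1)))"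
    unfolding eq
    by (intro Bochner_Integration.integrable_sum integrable_mult_right cov(1))
  have inner: "integrable M (\<lambda>\<omega>. \<Sum>q\<in>J. a p * b q * (((U p \<omega>)\<^sup>2 - 1) * ((V q \<omega>)\<^sup>2 - 1)))"
    "expectation (\<lambda>\<omega>. \<Sum>q\<in>J. a p * b q * (((U p \<omega>)\<^sup>2 - 1) * ((V q \<omega>)\<^sup>2 - 1))) =
      (\<Sum>q\<in>J. a p * b q * (2 * (expectation (\<lambda>\<omega>. U p \<omega> * V q \<omega>))\<^sup>2))" if "p \<in> I" for p
    using that by (simp_all add: cov)
  show "expectation (\<lambda>\<omega>. (\<Sum>p\<in>I. a p * ((U p \<omega>)\<^sup>2 - 1)) * (\<Sum>q\<in>J. b q * ((V q \<omega>)\<^sup>2 - 1))) =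
      (\<Sum>p\<in>I. \<Sum>q\<in>J. a p * b q * (2 * (expectation (\<lambda>\<omega>. U p \<omega> * V q \<omega>))\<^sup>2))"
    unfolding eq by (subst Bochner_Integration.integral_sum) (simp_all only: inner cong: sum.cong)
qed

text \<open>By Bessel's inequality the sums in \<open>parseval\<close> cannot exceed 1, so that
  hypothesis says that each \<open>U p\<close> lies in the span of the orthonormal family
  \<open>V\<close>, up to null sets.\<close>

lemma variance_sum_of_squares_ge:
  assumes "finite I" "finite J" "J \<noteq> {}"
    and U: "\<And>p. p \<in> I \<Longrightarrow> U p \<in> H" "\<And>p. p \<in> I \<Longrightarrow> expectation (\<lambda>\<omega>. (U p \<omega>)\<^sup>2) = 1"
    and V: "\<And>q. q \<in> J \<Longrightarrow> V q \<in> H" "\<And>q. q \<in> J \<Longrightarrow> expectation (\<lambda>\<omega>. (V q \<omega>)\<^sup>2) = 1"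
    and orth: "\<And>q r. q \<in> J \<Longrightarrow> r \<in> J \<Longrightarrow> q \<noteq> r \<Longrightarrow> expectation (\<lambda>\<omega>. V q \<omega> * V r \<omega>) = 0"
    and parseval: "\<And>p. p \<in> I \<Longrightarrow> (\<Sum>q\<in>J. (expectation (\<lambda>\<omega>. U p \<omega> * V q \<omega>))\<^sup>2) \<ge> 1"
    and a: "\<And>p. p \<in> I \<Longrightarrow> a p \<ge> 0"
  shows "variance (\<lambda>\<omega>. \<Sum>p\<in>I. a p * ((U p \<omega>)\<^sup>2 - 1)) \<ge> 2 * (\<Sum>p\<in>I. a p)\<^sup>2 / card J"
proof -
  define X where "X = (\<lambda>\<omega>. \<Sum>p\<in>I. a p * ((U p \<omega>)\<^sup>2 - 1))"
  \<comment> \<open>The factor 1 gives \<open>Y\<close> the weighted form that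
    \<open>covariance_sums_of_squares\<close> expects.\<close>
  define Y where "Y = (\<lambda>\<omega>. \<Sum>q\<in>J. 1 * ((V q \<omega>)\<^sup>2 - 1))"
  define S where "S = (\<Sum>p\<in>I. a p)"
  define N where "N = real (card J)"
  \<comment> \<open>This is the least-squares coefficient of \<open>X\<close> on \<open>Y\<close>
    when their covariance is exactly \<open>2 * S\<close>, as the variance of \<open>Y\<close> is
    \<open>2 * N\<close>.\<close>
  define c where "c = S / N"
  have "N > 0"
    using assms(2,3) by (simp add: N_def card_gt_0_iff)
  have "S \<ge> 0"
    unfolding S_def using a by (rule sum_nonneg)
  have "c \<ge> 0"
    using \<open>N > 0\<close> \<open>S \<ge> 0\<close> by (simp add: c_def)
  have "expectation X = (\<Sum>p\<in>I. expectation (\<lambda>\<omega>. a p * ((U p \<omega>)\<^sup>2 - 1)))"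
    unfolding X_def using U(1)
    by (intro Bochner_Integration.integral_sum integrable_mult_right
        Bochner_Integration.integrable_diff moments(2)) auto
  also have "\<dots> = 0"
    using U by (intro sum.neutral ballI) (simp add: moments(2) prob_space)
  finally have "expectation X = 0" .
  have XX: "integrable M (\<lambda>\<omega>. X \<omega> * X \<omega>)"
    unfolding X_def using assms(1) U by (intro covariance_sums_of_squares)
  have XY: "integrable M (\<lambda>\<omega>. X \<omega> * Y \<omega>)"
    unfolding X_def Y_def using assms(1,2) U V by (intro covariance_sums_of_squares)
  have YY: "integrable M (\<lambda>\<omega>. Y \<omega> * Y \<omega>)"
    unfolding Y_def using assms(2) V by (intro covariance_sums_of_squares)
  have "expectation (\<lambda>\<omega>. Y \<omega> * Y \<omega>) =
      (\<Sum>q\<in>J. \<Sum>r\<in>J. 1 * 1 * (2 * (expectation (\<lambda>\<omega>. V q \<omega> * V r \<omega>))\<^sup>2))"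
    unfolding Y_def using assms(2) V by (intro covariance_sums_of_squares)
  also have "\<dots> = (\<Sum>q\<in>J. \<Sum>r\<in>J. if q = r then 2 else 0)"
    using orth V(2) by (intro sum.cong refl) (auto simp: power2_eq_square)
  also have "\<dots> = 2 * N"
    using assms(2) by (simp add: N_def)
  finally have EYY: "expectation (\<lambda>\<omega>. Y \<omega> * Y \<omega>) = 2 * N" .
  have "2 * S \<le> (\<Sum>p\<in>I. a p * (2 * (\<Sum>q\<in>J. (expectation (\<lambda>\<omega>. U p \<omega> * V q \<omega>))\<^sup>2)))"
    unfolding S_def sum_distrib_left[of 2 a]
  proof (rule sum_mono)
    fix p assume "p \<in> I"
    then show "2 * a p \<le> a p * (2 * (\<Sum>q\<in>J. (expectation (\<lambda>\<omega>. U p \<omega> * V q \<omega>))\<^sup>2))"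
      using mult_left_mono[OF parseval a, of p p] by simp
  qed
  also have "\<dots> = (\<Sum>p\<in>I. \<Sum>q\<in>J. a p * 1 * (2 * (expectation (\<lambda>\<omega>. U p \<omega> * V q \<omega>))\<^sup>2))"
    by (simp add: sum_distrib_left)
  also have "\<dots> = expectation (\<lambda>\<omega>. X \<omega> * Y \<omega>)"
    unfolding X_def Y_def using assms(1,2) U V
    by (intro covariance_sums_of_squares(2)[symmetric])
  finally have EXY: "2 * S \<le> expectation (\<lambda>\<omega>. X \<omega> * Y \<omega>)" .
  have "0 \<le> expectation (\<lambda>\<omega>. (X \<omega> - c * Y \<omega>)\<^sup>2)"
    by simp
  also have "(\<lambda>\<omega>. (X \<omega> - c * Y \<omega>)\<^sup>2) =
      (\<lambda>\<omega>. X \<omega> * X \<omega> - 2 * c * (X \<omega> * Y \<omega>) + c\<^sup>2 * (Y \<omega> * Y \<omega>))"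
    by (rule ext) (simp add: power2_eq_square algebra_simps)
  also have "expectation \<dots> = expectation (\<lambda>\<omega>. X \<omega> * X \<omega>)
      - 2 * c * expectation (\<lambda>\<omega>. X \<omega> * Y \<omega>) + c\<^sup>2 * expectation (\<lambda>\<omega>. Y \<omega> * Y \<omega>)"
    using XX XY YY by simp
  \<comment> \<open>The covariance is only bounded below and enters with a minus sign, hence the
    need for \<open>c \<ge> 0\<close>.\<close>
  also have "\<dots> \<le> expectation (\<lambda>\<omega>. X \<omega> * X \<omega>) - 2 * c * (2 * S) + c\<^sup>2 * (2 * N)"
    using mult_left_mono[OF EXY, of "2 * c"] \<open>c \<ge> 0\<close> EYY by simp
  also have "\<dots> = expectation (\<lambda>\<omega>. X \<omega> * X \<omega>) - 2 * S\<^sup>2 / N"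
    using \<open>N > 0\<close> by (simp add: c_def power2_eq_square field_simps)
  finally have "2 * S\<^sup>2 / N \<le> variance X"
    using variance_mean_zero[OF \<open>expectation X = 0\<close>] by (simp add: power2_eq_square)
  then show ?thesis
    unfolding X_def S_def N_def .
qed

end

section \<open>The linear span of a Gaussian process\<close>

definition linear_combinations :: "('t \<Rightarrow> 'a \<Rightarrow> real) \<Rightarrow> 't set \<Rightarrow> ('a \<Rightarrow> real) set" where
  "linear_combinations Z T = {\<lambda>\<omega>. \<Sum>t\<in>F. c t * Z t \<omega> | F c. finite F \<and> F \<subseteq> T}"

lemma linear_combinations_base: "t \<in> T \<Longrightarrow> Z t \<in> linear_combinations Z T"
  unfolding linear_combinations_def
  by (rule CollectI, rule exI[of _ "{t}"], rule exI[of _ "\<lambda>_. 1"]) simp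

lemma linear_combinations_lincomb:
  assumes "X \<in> linear_combinations Z T" "Y \<in> linear_combinations Z T"
  shows "(\<lambda>\<omega>. a * X \<omega> + b * Y \<omega>) \<in> linear_combinations Z T"
proof -
  obtain F c where F: "finite F" "F \<subseteq> T" "X = (\<lambda>\<omega>. \<Sum>t\<in>F. c t * Z t \<omega>)"
    using assms(1) unfolding linear_combinations_def by blast
  obtain G d where G: "finite G" "G \<subseteq> T" "Y = (\<lambda>\<omega>. \<Sum>t\<in>G. d t * Z t \<omega>)"
    using assms(2) unfolding linear_combinations_def by blast
  \<comment> \<open>Coefficients are extended by zero to the union of the two supports, and add up
    on the overlap.\<close>
  define e where "e t = a * (if t \<in> F then c t else 0) + b * (if t \<in> G then d t else 0)" for t
  have "X \<omega> = (\<Sum>t\<in>F \<union> G. (if t \<in> F then c t else 0) * Z t \<omega>)" for \<omega>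
    unfolding F(3) using F(1) G(1) by (intro sum.mono_neutral_cong_left) auto
  moreover have "Y \<omega> = (\<Sum>t\<in>F \<union> G. (if t \<in> G then d t else 0) * Z t \<omega>)" for \<omega>
    unfolding G(3) using F(1) G(1) by (intro sum.mono_neutral_cong_left) auto
  ultimately have "(\<lambda>\<omega>. a * X \<omega> + b * Y \<omega>) = (\<lambda>\<omega>. \<Sum>t\<in>F \<union> G. e t * Z t \<omega>)"
    by (simp add: e_def sum_distrib_left distrib_right sum.distrib mult.assoc)
  then show ?thesis
    unfolding linear_combinations_def using F(1,2) G(1,2) by blast
qed

lemma centred_gaussian_space_linear_combinations:
  assumes "prob_space M" "gaussian_process M T Z"
    and zero: "\<And>t. t \<in> T \<Longrightarrow> prob_space.expectation M (Z t) = 0"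
  shows "centred_gaussian_space M (linear_combinations Z T)"
proof -
  interpret prob_space M by fact
  have gauss: "gaussian_rv M X" if "X \<in> linear_combinations Z T" for X
    using that assms(2) unfolding linear_combinations_def gaussian_process_def by blast
  \<comment> \<open>A zero expectation does not give integrability, because the integral of a
    non-integrable function is 0 by default. Gaussianity supplies it.\<close>
  have "integrable M (Z t)" if "t \<in> T" for t
    using centred_gaussian_moments(1)[OF gauss[OF linear_combinations_base] zero] that by blast
  then have "expectation X = 0" if "X \<in> linear_combinations Z T" for X
    using that zero unfolding linear_combinations_def
    by (auto intro!: sum.neutral simp: subset_iff)
  then show ?thesis
    using gauss by unfold_locales (auto intro: linear_combinations_lincomb)
qed

section \<open>Innovations of the process along one row of design points\<close>

locale ou_design = prob_space M for M :: "'a measure" +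
  fixes Z :: "real \<Rightarrow> 'a \<Rightarrow> real" and T :: "real set" and \<theta> \<sigma>2 :: real
    and x :: "nat \<Rightarrow> real" and n :: nat
  assumes \<theta>: "\<theta> > 0" and \<sigma>2: "\<sigma>2 > 0"
    and process: "gaussian_process M T Z"
    and zero: "\<And>t. t \<in> T \<Longrightarrow> expectation (Z t) = 0"
    and cov: "\<And>t u. t \<in> T \<Longrightarrow> u \<in> T \<Longrightarrow> covariance M (Z t) (Z u) = \<sigma>2 * exp (- \<theta> * \<bar>t - u\<bar>)"
    and x_mono: "strict_mono_on {1..n} x"
    and x_T: "\<And>i. i \<in> {1..n} \<Longrightarrow> x i \<in> T"
begin

sublocale centred_gaussian_space M "linear_combinations Z T"
  using prob_space_axioms process zero by (rule centred_gaussian_space_linear_combinations)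

text \<open>For \<open>i \<le> j\<close> the ratio \<open>r i / r j\<close> is the correlation of \<open>Z (x i)\<close> and \<open>Z (x j)\<close>; this
  product form makes all covariances below rational functions of the \<open>r i\<close>.\<close>

definition r :: "nat \<Rightarrow> real" where
  "r i = exp (\<theta> * x i)"

text \<open>For \<open>i < j\<close> this is the error of the best linear predictor of
  \<open>Z (x j)\<close> from \<open>Z (x i)\<close>, and \<open>v i j\<close> below is its
  variance.\<close>

definition D :: "nat \<Rightarrow> nat \<Rightarrow> 'a \<Rightarrow> real" where
  "D i j \<omega> = Z (x j) \<omega> - r i / r j * Z (x i) \<omega>"

definition v :: "nat \<Rightarrow> nat \<Rightarrow> real" where
  "v i j = \<sigma>2 * (1 - (r i / r j)\<^sup>2)"

definition W :: "nat \<Rightarrow> nat \<Rightarrow> 'a \<Rightarrow> real" where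
  "W i j \<omega> = 1 / sqrt (v i j) * D i j \<omega>"

lemma r_pos [simp]: "r i > 0" "r i \<noteq> 0"
  by (simp_all add: r_def)

lemma exp_eq_r:
  "exp (- \<theta> * (x j - x i)) = r i / r j" "exp (- 2 * \<theta> * (x j - x i)) = (r i / r j)\<^sup>2"
proof -
  show "exp (- \<theta> * (x j - x i)) = r i / r j"
    unfolding r_def by (simp add: algebra_simps flip: exp_diff)
  then have "(r i / r j)\<^sup>2 = (exp (- \<theta> * (x j - x i)))\<^sup>2"
    by simp
  then show "exp (- 2 * \<theta> * (x j - x i)) = (r i / r j)\<^sup>2"
    by (simp add: power2_eq_square algebra_simps flip: exp_add)
qed

lemma x_less: "1 \<le> i \<Longrightarrow> i < j \<Longrightarrow> j \<le> n \<Longrightarrow> x i < x j"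
  using strict_mono_onD[OF x_mono, of i j] by simp

lemma x_le: "1 \<le> i \<Longrightarrow> i \<le> j \<Longrightarrow> j \<le> n \<Longrightarrow> x i \<le> x j"
  using x_less[of i j] by (cases "i = j") auto

lemma v_pos: "1 \<le> i \<Longrightarrow> i < j \<Longrightarrow> j \<le> n \<Longrightarrow> v i j > 0"
  using x_less[of i j] \<theta> \<sigma>2 unfolding v_def exp_eq_r(2)[symmetric] by simp

lemma expectation_Z:
  assumes "1 \<le> i" "i \<le> j" "j \<le> n"
  shows "expectation (\<lambda>\<omega>. Z (x i) \<omega> * Z (x j) \<omega>) = \<sigma>2 * (r i / r j)"
    "expectation (\<lambda>\<omega>. Z (x j) \<omega> * Z (x i) \<omega>) = \<sigma>2 * (r i / r j)"
proof -
  have "covariance M (Z (x i)) (Z (x j)) = \<sigma>2 * (r i / r j)"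
    using cov[of "x i" "x j"] x_T[of i] x_T[of j] x_le[of i j] assms
    by (simp add: abs_minus_commute flip: exp_eq_r)
  then show "expectation (\<lambda>\<omega>. Z (x i) \<omega> * Z (x j) \<omega>) = \<sigma>2 * (r i / r j)"
    unfolding covariance_def using zero[of "x i"] zero[of "x j"] x_T[of i] x_T[of j] assms by simp
  then show "expectation (\<lambda>\<omega>. Z (x j) \<omega> * Z (x i) \<omega>) = \<sigma>2 * (r i / r j)"
    by (simp add: mult.commute)
qed

lemma Z_in: "i \<in> {1..n} \<Longrightarrow> Z (x i) \<in> linear_combinations Z T"
  using x_T by (rule linear_combinations_base)

lemma D_in: "i \<in> {1..n} \<Longrightarrow> j \<in> {1..n} \<Longrightarrow> D i j \<in> linear_combinations Z T"
  using lincomb[OF Z_in Z_in, of j i 1 "- (r i / r j)"] by (simp add: D_def[abs_def])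

lemma W_in: "i \<in> {1..n} \<Longrightarrow> j \<in> {1..n} \<Longrightarrow> W i j \<in> linear_combinations Z T"
  unfolding W_def[abs_def] by (intro scale D_in)

lemma expectation_D:
  assumes "i \<in> {1..n}" "j \<in> {1..n}" "k \<in> {1..n}" "l \<in> {1..n}"
  shows "expectation (\<lambda>\<omega>. D i j \<omega> * D k l \<omega>) =
    expectation (\<lambda>\<omega>. Z (x j) \<omega> * Z (x l) \<omega>)
    - r k / r l * expectation (\<lambda>\<omega>. Z (x j) \<omega> * Z (x k) \<omega>)
    - r i / r j * expectation (\<lambda>\<omega>. Z (x i) \<omega> * Z (x l) \<omega>)
    + r i / r j * (r k / r l) * expectation (\<lambda>\<omega>. Z (x i) \<omega> * Z (x k) \<omega>)"
  unfolding D_def by (intro expectation_mult_lincomb Z_in assms)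

text \<open>The process \<open>r i * Z (x i)\<close> has uncorrelated increments with variance clock
  \<open>\<sigma>2 * (r i)\<^sup>2\<close>, and \<open>r j * D i j\<close> is its increment from
  \<open>i\<close> to \<open>j\<close>. The covariance with a sub-increment is the variance of that
  sub-increment; dividing by \<open>r j * r l\<close> gives the formula.\<close>

lemma expectation_D_nested:
  assumes "1 \<le> i" "i \<le> k" "k < l" "l \<le> j" "j \<le> n"
  shows "expectation (\<lambda>\<omega>. D i j \<omega> * D k l \<omega>) = r l / r j * v k l"
  using assms
  by (simp add: expectation_D expectation_Z v_def field_simps power2_eq_square)

text \<open>Here the two increments of \<open>r i * Z (x i)\<close> do not overlap.\<close>

lemma expectation_D_disjoint:
  assumes "1 \<le> i" "i < j" "j \<le> k" "k < l" "l \<le> n"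
  shows "expectation (\<lambda>\<omega>. D i j \<omega> * D k l \<omega>) = 0"
  using assms by (simp add: expectation_D expectation_Z field_simps power2_eq_square)

lemma expectation_W:
  "expectation (\<lambda>\<omega>. W i j \<omega> * W k l \<omega>) =
    expectation (\<lambda>\<omega>. D i j \<omega> * D k l \<omega>) / (sqrt (v i j) * sqrt (v k l))"
proof -
  have eq: "W i j \<omega> * W k l \<omega> = D i j \<omega> * D k l \<omega> / (sqrt (v i j) * sqrt (v k l))" for \<omega>
    by (simp add: W_def)
  show ?thesis
    unfolding eq by simp
qed

lemma W_normalised:
  assumes "1 \<le> i" "i < j" "j \<le> n"
  shows "expectation (\<lambda>\<omega>. (W i j \<omega>)\<^sup>2) = 1"
  using v_pos[OF assms] expectation_W[of i j i j] expectation_D_nested[of i i j j] assms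
  by (simp add: power2_eq_square)

lemma W_orthogonal:
  assumes "1 \<le> i" "i < j" "j \<le> k" "k < l" "l \<le> n"
  shows "expectation (\<lambda>\<omega>. W i j \<omega> * W k l \<omega>) = 0" "expectation (\<lambda>\<omega>. W k l \<omega> * W i j \<omega>) = 0"
  using expectation_D_disjoint[OF assms] expectation_W[of i j k l]
  by (simp_all add: mult.commute)

text \<open>Each squared correlation is the fraction of the clock time from \<open>i\<close> to
  \<open>j\<close> that is spent between \<open>m\<close> and \<open>m + 1\<close>, and these
  fractions add up to 1.\<close>

lemma W_parseval:
  assumes "1 \<le> i" "i < j" "j \<le> n"
  shows "(\<Sum>m=i..<j. (expectation (\<lambda>\<omega>. W i j \<omega> * W m (Suc m) \<omega>))\<^sup>2) = 1"
proof -
  \<comment> \<open>The clock at \<open>m\<close>, rescaled so that it advances by exactly 1 between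
    \<open>i\<close> and \<open>j\<close>. The sum telescopes along it.\<close>
  define g where "g m = \<sigma>2 * (r m / r j)\<^sup>2 / v i j" for m
  have "(\<Sum>m=i..<j. (expectation (\<lambda>\<omega>. W i j \<omega> * W m (Suc m) \<omega>))\<^sup>2) = (\<Sum>m=i..<j. g (Suc m) - g m)"
  proof (rule sum.cong)
    fix m assume m: "m \<in> {i..<j}"
    have pos: "v m (Suc m) > 0" "v i j > 0"
      using v_pos m assms by auto
    have "(expectation (\<lambda>\<omega>. W i j \<omega> * W m (Suc m) \<omega>))\<^sup>2 =
        (r (Suc m) / r j)\<^sup>2 * v m (Suc m) / v i j"
      unfolding expectation_W using pos m assms
      by (subst expectation_D_nested)
        (simp_all add: power_divide power_mult_distrib, simp add: power2_eq_square)
    also have "(r (Suc m) / r j)\<^sup>2 * v m (Suc m) =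
        \<sigma>2 * (r (Suc m) / r j)\<^sup>2 - \<sigma>2 * (r m / r j)\<^sup>2"
      unfolding v_def by (simp add: field_simps)
    finally show "(expectation (\<lambda>\<omega>. W i j \<omega> * W m (Suc m) \<omega>))\<^sup>2 = g (Suc m) - g m"
      by (simp add: g_def diff_divide_distrib)
  qed simp
  also have "\<dots> = g j - g i"
    using assms by (simp add: sum_Suc_diff')
  also have "\<dots> = v i j / v i j"
    unfolding g_def diff_divide_distrib[symmetric] by (simp add: v_def right_diff_distrib)
  also have "\<dots> = 1"
    using v_pos[OF assms] by simp
  finally show ?thesis .
qed

lemma W_sq_eq:
  assumes "1 \<le> i" "1 \<le> k" "i + k \<le> n"
  shows "W_sq \<theta> \<sigma>2 Z x i k = (\<lambda>\<omega>. (W i (i + k) \<omega>)\<^sup>2)"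
  using v_pos[of i "i + k"] assms
  by (intro ext) (simp add: W_sq_def exp_eq_r[of "i + k" i, simplified] W_def D_def v_def power_mult_distrib power_divide)

lemma variance_W_sq_ge:
  assumes "n \<ge> 2" and I: "finite I" "I \<subseteq> {(i, k). 1 \<le> i \<and> 1 \<le> k \<and> i + k \<le> n}"
    and a: "\<And>i k. (i, k) \<in> I \<Longrightarrow> a i k \<ge> 0"
  shows "variance (\<lambda>\<omega>. \<Sum>(i, k)\<in>I. a i k * (W_sq \<theta> \<sigma>2 Z x i k \<omega> - 1)) \<ge>
    2 * (\<Sum>(i, k)\<in>I. a i k)\<^sup>2 / (real n - 1)"
proof -
  define U where "U p = W (fst p) (fst p + snd p)" for p
  have eq: "(\<Sum>(i, k)\<in>I. a i k * (W_sq \<theta> \<sigma>2 Z x i k \<omega> - 1)) =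
      (\<Sum>p\<in>I. (case p of (i, k) \<Rightarrow> a i k) * ((U p \<omega>)\<^sup>2 - 1))" for \<omega>
    using I(2) by (intro sum.cong refl) (auto simp: W_sq_eq U_def)
  \<comment> \<open>There are \<open>n - 1\<close> innovations for \<open>n\<close> points;
    \<open>n \<ge> 2\<close> makes their index set nonempty.\<close>
  have card: "real (card {1..<n}) = real n - 1"
    using assms(1) by simp
  show ?thesis
    unfolding eq card[symmetric]
  proof (rule variance_sum_of_squares_ge)
    show "finite I" "finite {1..<n}" "{1..<n} \<noteq> {}"
      using I assms(1) by auto
  next
    fix p assume p: "p \<in> I"
    obtain i k where ik: "p = (i, k)" "1 \<le> i" "1 \<le> k" "i + k \<le> n"
      using p I(2) by (cases p) auto
    show "U p \<in> linear_combinations Z T"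
      unfolding U_def using ik by (intro W_in) auto
    show "expectation (\<lambda>\<omega>. (U p \<omega>)\<^sup>2) = 1"
      unfolding U_def using ik by (intro W_normalised) auto
    show "0 \<le> (case p of (i, k) \<Rightarrow> a i k)"
      using a p ik by auto
    have "1 = (\<Sum>m=i..<i + k. (expectation (\<lambda>\<omega>. W i (i + k) \<omega> * W m (Suc m) \<omega>))\<^sup>2)"
      using ik by (intro W_parseval[symmetric]) auto
    \<comment> \<open>Enlarging the range to all innovations adds only squares, so the orthonormal
      family can be the same for every pair.\<close>
    also have "\<dots> \<le> (\<Sum>m=1..<n. (expectation (\<lambda>\<omega>. W i (i + k) \<omega> * W m (Suc m) \<omega>))\<^sup>2)"
      using ik by (intro sum_mono2) auto
    finally show "1 \<le> (\<Sum>m=1..<n. (expectation (\<lambda>\<omega>. U p \<omega> * W m (Suc m) \<omega>))\<^sup>2)"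
      by (simp add: U_def ik)
  next
    fix m assume "m \<in> {1..<n}"
    then show "W m (Suc m) \<in> linear_combinations Z T" "expectation (\<lambda>\<omega>. (W m (Suc m) \<omega>)\<^sup>2) = 1"
      by (auto intro!: W_in W_normalised)
  next
    fix m m' assume "m \<in> {1..<n}" "m' \<in> {1..<n}" "m \<noteq> m'"
    then show "expectation (\<lambda>\<omega>. W m (Suc m) \<omega> * W m' (Suc m') \<omega>) = 0"
      using W_orthogonal[of m "Suc m" m' "Suc m'"] W_orthogonal[of m' "Suc m'" m "Suc m"]
      by (cases "m < m'") auto
  qed
qed

text \<open>Exactly the indices \<open>i \<le> n - K\<close> have room for all \<open>K\<close>
  lags. Keeping only these costs the factor \<open>(n - K) / n\<close>, squared because the bound is
  quadratic in the total weight.\<close>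

lemma tau_sq_ge:
  assumes w: "\<And>k. k \<ge> 1 \<Longrightarrow> w k \<ge> 0" and K: "max_lag w = enat K" and n: "n \<ge> 2" "n > K"
    and s: "s n = x"
  shows "tau_sq M \<theta> \<sigma>2 Z w s n \<ge> 2 * (\<Sum>k=1..K. w k)\<^sup>2 * ((real n - real K) / real n)\<^sup>2"
proof -
  define I where "I = (SIGMA i:{1..n - 1}. {1..min K (n - i)})"
  define S where "S = (\<Sum>k=1..K. w k)"
  have "S \<ge> 0"
    unfolding S_def using w by (intro sum_nonneg) auto
  have "(real n - real K) * S = (\<Sum>i=1..n - K. S)"
    using n by (simp add: of_nat_diff)
  also have "\<dots> \<le> (\<Sum>i=1..n - 1. \<Sum>k=1..min K (n - i). w k)"
  \<comment> \<open>For \<open>K = 0\<close> the range \<open>{1..n - K}\<close> is not contained in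
    \<open>{1..n - 1}\<close>, but then \<open>S\<close> is an empty sum.\<close>
  proof (cases "K = 0")
    case True
    then show ?thesis by (simp add: S_def)
  next
    case False
    have "(\<Sum>i=1..n - K. S) = (\<Sum>i=1..n - K. \<Sum>k=1..min K (n - i). w k)"
      by (intro sum.cong refl) (auto simp: S_def min_def)
    also have "\<dots> \<le> (\<Sum>i=1..n - 1. \<Sum>k=1..min K (n - i). w k)"
      using False w by (intro sum_mono2 sum_nonneg) auto
    finally show ?thesis .
  qed
  also have "\<dots> = (\<Sum>(i, k)\<in>I. w k)"
    unfolding I_def by (subst sum.Sigma) auto
  finally have S_le: "(real n - real K) * S \<le> (\<Sum>(i, k)\<in>I. w k)" .
  \<comment> \<open>Weakening \<open>n - 1\<close> to \<open>n\<close> in the denominator leaves a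
    clean square once \<open>tau_sq\<close> contributes its own factor \<open>1 / n\<close>.\<close>
  have "2 * ((real n - real K) * S)\<^sup>2 / real n \<le> 2 * (\<Sum>(i, k)\<in>I. w k)\<^sup>2 / (real n - 1)"
    using S_le n \<open>S \<ge> 0\<close> by (intro frac_le mult_left_mono power_mono) auto
  also have "\<dots> \<le> variance (\<lambda>\<omega>. \<Sum>(i, k)\<in>I. w k * (W_sq \<theta> \<sigma>2 Z x i k \<omega> - 1))"
    using n w by (intro variance_W_sq_ge) (auto simp: I_def)
  also have "(\<lambda>\<omega>. \<Sum>(i, k)\<in>I. w k * (W_sq \<theta> \<sigma>2 Z x i k \<omega> - 1)) =
      (\<lambda>\<omega>. \<Sum>i=1..n - 1. \<Sum>k=1..min K (n - i). w k * (W_sq \<theta> \<sigma>2 Z x i k \<omega> - 1))"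
    unfolding I_def by (subst sum.Sigma) auto
  finally have "2 * ((real n - real K) * S)\<^sup>2 / real n \<le> real n * tau_sq M \<theta> \<sigma>2 Z w s n"
    using n unfolding tau_sq_def K s by simp
  then show ?thesis
    using n by (simp add: S_def field_simps power2_eq_square)
qed

end

section \<open>Passage to the limit\<close>

theorem lemma3:
  fixes M :: "'a measure"
    and Z :: "real \<Rightarrow> 'a \<Rightarrow> real"
    and \<theta>\<^sub>0 \<sigma>2\<^sub>0 :: real
    and s :: "nat \<Rightarrow> nat \<Rightarrow> real"
    and w :: "nat \<Rightarrow> real"
  assumes "prob_space M"
    and "\<theta>\<^sub>0 > 0" and "\<sigma>2\<^sub>0 > 0"
    and "gaussian_process M {0..1} Z"
    and "stationary_process M {0..1} Z"
    and "\<And>t. t \<in> {0..1} \<Longrightarrow> prob_space.expectation M (Z t) = 0"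
    and "\<And>t u. t \<in> {0..1} \<Longrightarrow> u \<in> {0..1} \<Longrightarrow>
           covariance M (Z t) (Z u) = \<sigma>2\<^sub>0 * exp (- \<theta>\<^sub>0 * \<bar>t - u\<bar>)"
    and "\<And>n. strict_mono_on {1..n} (s n)"
    and "\<And>n i. i \<in> {1..n} \<Longrightarrow> s n i \<in> {0..1}"
    and "\<And>k. k \<ge> 1 \<Longrightarrow> w k \<ge> 0"
    and "\<exists>k\<ge>1. w k \<noteq> 0"
    and "(\<lambda>n. Max ((\<lambda>i. s n (i + 1) - s n i) ` {1..n - 1})) \<longlonglongrightarrow> 0"
    and "max_lag w < \<infinity>"
  shows "liminf (\<lambda>n. ereal (tau_sq M \<theta>\<^sub>0 \<sigma>2\<^sub>0 Z w s n)) \<ge>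
           ereal (2 * (\<Sum>k=1..the_enat (max_lag w). w k)\<^sup>2)"
proof -
  obtain K where K: "max_lag w = enat K"
    using assms(13) by (cases "max_lag w") auto
  define S where "S = (\<Sum>k=1..K. w k)"
  define f where "f n = 2 * S\<^sup>2 * ((real n - real K) / real n)\<^sup>2" for n
  \<comment> \<open>The threshold ensures at least one innovation and \<open>n > K\<close>; each row
    \<open>s n\<close> is then a design of its own.\<close>
  have "f n \<le> tau_sq M \<theta>\<^sub>0 \<sigma>2\<^sub>0 Z w s n" if "n \<ge> max 2 (Suc K)" for n
  proof -
    interpret prob_space M by fact
    interpret ou_design M Z "{0..1}" \<theta>\<^sub>0 \<sigma>2\<^sub>0 "s n" n
      using assms by unfold_locales auto
    show ?thesis
      unfolding f_def S_def using assms(10) K that by (intro tau_sq_ge) auto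
  qed
  then have "eventually (\<lambda>n. ereal (f n) \<le> ereal (tau_sq M \<theta>\<^sub>0 \<sigma>2\<^sub>0 Z w s n)) sequentially"
    unfolding eventually_sequentially ereal_less_eq by blast
  then have "liminf (\<lambda>n. ereal (f n)) \<le> liminf (\<lambda>n. ereal (tau_sq M \<theta>\<^sub>0 \<sigma>2\<^sub>0 Z w s n))"
    by (rule Liminf_mono)
  \<comment> \<open>As \<open>K\<close> is finite and fixed, the boundary loss vanishes, and the
    lower bounds converge to the required constant.\<close>
  moreover have "(\<lambda>n. (real n - real K) / real n) \<longlonglongrightarrow> 1"
    by real_asymp
  then have "f \<longlonglongrightarrow> 2 * S\<^sup>2 * 1\<^sup>2"
    unfolding f_def by (intro tendsto_intros)
  then have "liminf (\<lambda>n. ereal (f n)) = ereal (2 * S\<^sup>2)"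
    by (intro lim_imp_Liminf) auto
  ultimately show ?thesis
    by (simp add: K S_def)
qed

end
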